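(* For any $f\in C^{2}[0,1]$ and any $\mu_{0}\in(0,1)$, there exists $n_{1}=n_1(f,\mu_{0})\in\mathbb{N}$ (depending on $f$ and $\mu_{0}$) such that for all $n\ge n_{1}$, $$\frac{\mu_{0}}{32}\cdot\omega^{2}_{\varphi}\left(f,\frac{1}{\sqrt{n}}\right)\le \|f-B_nf\|\le 3\cdot\omega^{2}_{\varphi}\left(f,\frac{1}{\sqrt{n}}\right).$$
   Context: $\mathbb{N}=\{1,2,3,\dots\}$. $C^{2}[0,1]$ is the set of twice continuously differentiable functions $f:[0,1]\to\mathbb{R}$. $\|\cdot\|$ denotes the uniform norm on $C[0,1]$. For $f\in C[0,1]$ and $n\in\mathbb{N}$, the Bernstein polynomial is $B_nf(x)=B_n(f;x)=\sum_{k=0}^{n}f\left(\frac{k}{n}\right)\binom{n}{k}x^{k}(1-x)^{n-k}$, $x\in[0,1]$. Let $\varphi(x)=\sqrt{x(1-x)}$. The second order Ditzian-Totik modulus of smoothness $\omega^{2}_{\varphi}(f,\delta)$ (the superscript $2$ denotes the order, not a square) is $$\omega^{2}_{\varphi}(f,\delta)=\sup_{0\le h\le\delta}\ \sup\left\{|f(x+h\varphi(x))-2f(x)+f(x-h\varphi(x))| : x\in\left[\tfrac{h^{2}}{1+h^{2}},\tfrac{1}{1+h^{2}}\right]\right\},\qquad 0\le\delta\le 1.$$ (The condition on $x$ is exactly that $x\pm h\varphi(x)\in[0,1]$.) *)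

theory Defs
  imports "HOL-Analysis.Analysis"
begin

text \<open>
  A function on the unit interval is represented by a total function on the reals;
  every definition below depends only on its values on the unit interval.
\<close>

text \<open>The derivatives are taken within the interval, hence one-sided at the endpoints.\<close>

definition C2_unit :: "(real \<Rightarrow> real) \<Rightarrow> bool" where
  "C2_unit f \<longleftrightarrow>
     (\<exists>f' f''. (\<forall>x\<in>{0..1}. (f has_real_derivative f' x) (at x within {0..1})) \<and>
               (\<forall>x\<in>{0..1}. (f' has_real_derivative f'' x) (at x within {0..1})) \<and>
               continuous_on {0..1} f'')"

definition unif_norm :: "(real \<Rightarrow> real) \<Rightarrow> real" where
  "unif_norm f = (SUP x\<in>{0..1}. \<bar>f x\<bar>)"

definition Bernstein_op :: "nat \<Rightarrow> (real \<Rightarrow> real) \<Rightarrow> real \<Rightarrow> real" where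
  "Bernstein_op n f x = (\<Sum>k=0..n. f (real k / real n) * Bernstein n k x)"

definition DT_phi :: "real \<Rightarrow> real" where
  "DT_phi x = sqrt (x * (1 - x))"

text \<open>
  The suprema are real-valued. They are the intended ones for \<open>0 \<le> \<delta> \<le> 1\<close> and \<open>f\<close> bounded
  on the unit interval: both index sets are then nonempty and the values are bounded.
\<close>

definition DT_modulus2 :: "(real \<Rightarrow> real) \<Rightarrow> real \<Rightarrow> real" where
  "DT_modulus2 f \<delta> =
     (SUP h\<in>{0..\<delta>}. SUP x\<in>{h\<^sup>2 / (1 + h\<^sup>2)..1 / (1 + h\<^sup>2)}.
        \<bar>f (x + h * DT_phi x) - 2 * f x + f (x - h * DT_phi x)\<bar>)"

end

theory Submission
  imports Defs
begin

text \<open>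
  For a fixed twice continuously differentiable f both quantities have the same order: with M the
  maximum of \<open>\<bar>x (1 - x) f''(x)\<bar>\<close>, second-order Taylor expansion shows that n times the norm
  tends to M/2 (Voronovskaya, with a fourth-moment bound for the remainder) and n times the modulus
  tends to M. If M = 0 then f is affine and both vanish.
\<close>

section \<open>Second-order Taylor expansion on the unit interval\<close>

text \<open>Once the parabola \<open>f2 x / 2 * (s - x)\<^sup>2\<close> is subtracted from
  \<open>f\<close>, the second derivative is \<open>f2 s - f2 x\<close>, so a first-order Taylor
  estimate sees only the oscillation of \<open>f2\<close> around \<open>x\<close>. Working within a
  convex \<open>S\<close> covers endpoints and allows localisation near \<open>x\<close>.\<close>

lemma Taylor2_within:
  fixes f f1 f2 :: "real \<Rightarrow> real"
  assumes "convex S" "x \<in> S" "t \<in> S"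
    and f1: "\<And>s. s \<in> S \<Longrightarrow> (f has_real_derivative f1 s) (at s within S)"
    and f2: "\<And>s. s \<in> S \<Longrightarrow> (f1 has_real_derivative f2 s) (at s within S)"
    and B: "\<And>s. s \<in> S \<Longrightarrow> \<bar>f2 s - f2 x\<bar> \<le> B"
  shows "\<bar>f t - (f x + f1 x * (t - x) + f2 x / 2 * (t - x)\<^sup>2)\<bar> \<le> B * (t - x)\<^sup>2"
proof -
  \<comment> \<open>\<open>g 0\<close>, \<open>g 1\<close>, \<open>g 2\<close> are the corrected
    function and its first two derivatives; at \<open>x\<close> the correction vanishes in
    \<open>g 0\<close> and \<open>g 1\<close>.\<close>
  define g where "g i s = (if i = 0 then f s - f2 x / 2 * (s - x)\<^sup>2
      else if i = 1 then f1 s - f2 x * (s - x) else f2 s - f2 x)" for i :: nat and s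
  \<comment> \<open>\<open>field_Taylor\<close> divides by \<open>fact 1\<close> here, hence the
    constant \<open>B\<close> instead of \<open>B / 2\<close>.\<close>
  have "norm (g 0 t - (\<Sum>i\<le>1. g i x * (t - x)^i / fact i)) \<le> B * norm (t - x)^(Suc 1) / fact 1"
  proof (rule field_Taylor[OF \<open>convex S\<close> _ _ \<open>x \<in> S\<close> \<open>t \<in> S\<close>])
    show "(g i has_field_derivative g (Suc i) s) (at s within S)" if "s \<in> S" "i \<le> 1" for i s
    proof (cases "i = 0")
      case True
      have *: "g 0 = (\<lambda>s. f s - f2 x / 2 * (s - x)\<^sup>2)" "g (Suc 0) s = f1 s - f2 x * (s - x)"
        by (auto simp: g_def)
      show ?thesis unfolding True *
        by (rule derivative_eq_intros f1[OF that(1)] refl | simp)+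
    next
      case False
      then have i: "i = 1" using that by simp
      have *: "g 1 = (\<lambda>s. f1 s - f2 x * (s - x))" "g (Suc 1) s = f2 s - f2 x"
        by (auto simp: g_def)
      show ?thesis unfolding i *
        by (rule derivative_eq_intros f2[OF that(1)] refl | simp)+
    qed
    show "norm (g (Suc 1) s) \<le> B" if "s \<in> S" for s
      using B[OF that] by (simp add: g_def)
  qed
  then show ?thesis by (simp add: g_def algebra_simps power2_eq_square)
qed

text \<open>Uniform continuity of \<open>f2\<close> handles points \<open>t\<close> within some
  \<open>d\<close> of \<open>x\<close>. For the others \<open>(t - x)\<^sup>2 / d\<^sup>2\<close> is
  at least 1, so a crude quadratic bound is absorbed by a quartic term. \<open>C\<close> is
  independent of \<open>x\<close>, and averaging the quartic term will cost only order
  \<open>1 / n\<^sup>2\<close>.\<close>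

lemma Taylor2_remainder_quartic:
  fixes f f1 f2 :: "real \<Rightarrow> real"
  assumes f1: "\<And>s. s \<in> {0..1} \<Longrightarrow> (f has_real_derivative f1 s) (at s within {0..1})"
    and f2: "\<And>s. s \<in> {0..1} \<Longrightarrow> (f1 has_real_derivative f2 s) (at s within {0..1})"
    and cont: "continuous_on {0..1} f2" and "\<epsilon> > 0"
  obtains C where "C \<ge> 0" "\<And>x t. x \<in> {0..1} \<Longrightarrow> t \<in> {0..1} \<Longrightarrow>
    \<bar>f t - (f x + f1 x * (t - x) + f2 x / 2 * (t - x)\<^sup>2)\<bar> \<le> \<epsilon> * (t - x)\<^sup>2 + C * (t - x)^4"
proof -
  have "uniformly_continuous_on {0..1} f2"
    using cont by (intro compact_uniformly_continuous) auto
  with \<open>\<epsilon> > 0\<close> obtain d where "d > 0" and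
    "\<forall>x\<in>{0..1}. \<forall>s\<in>{0..1}. dist s x < d \<longrightarrow> dist (f2 s) (f2 x) < \<epsilon>"
    unfolding uniformly_continuous_on_def by meson
  then have d: "\<bar>f2 s - f2 x\<bar> < \<epsilon>" if "x \<in> {0..1}" "s \<in> {0..1}" "\<bar>s - x\<bar> < d" for x s
    using that by (simp add: dist_real_def)
  have "bounded (f2 ` {0..1})"
    using cont by (intro compact_imp_bounded compact_continuous_image) auto
  then obtain K where K: "\<And>s. s \<in> {0..1} \<Longrightarrow> \<bar>f2 s\<bar> \<le> K"
    by (force simp: bounded_iff)
  have "K \<ge> 0" using K[of 0] by simp
  show thesis
  proof (rule that)
    show "2 * K / d\<^sup>2 \<ge> 0" using \<open>K \<ge> 0\<close> by simp
    fix x t :: real assume x: "x \<in> {0..1}" and t: "t \<in> {0..1}"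
    let ?R = "\<bar>f t - (f x + f1 x * (t - x) + f2 x / 2 * (t - x)\<^sup>2)\<bar>"
    show "?R \<le> \<epsilon> * (t - x)\<^sup>2 + 2 * K / d\<^sup>2 * (t - x)^4"
    proof (cases "\<bar>t - x\<bar> < d")
      case True
      \<comment> \<open>Cutting with the ball keeps every \<open>s\<close> in the Taylor estimate
        within \<open>d\<close> of \<open>x\<close>.\<close>
      let ?S = "{0..1} \<inter> ball x d"
      have "?R \<le> \<epsilon> * (t - x)\<^sup>2"
      proof (rule Taylor2_within[where S = ?S])
        show "convex ?S" by (intro convex_Int) auto
        show "x \<in> ?S" "t \<in> ?S" using x t True \<open>d > 0\<close> by (auto simp: dist_real_def)
        show "(f has_real_derivative f1 s) (at s within ?S)" if "s \<in> ?S" for s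
          by (rule DERIV_subset[OF f1]) (use that in auto)
        show "(f1 has_real_derivative f2 s) (at s within ?S)" if "s \<in> ?S" for s
          by (rule DERIV_subset[OF f2]) (use that in auto)
        show "\<bar>f2 s - f2 x\<bar> \<le> \<epsilon>" if "s \<in> ?S" for s
          using d[OF x, of s] that by (force simp: dist_real_def)
      qed
      then show ?thesis using \<open>K \<ge> 0\<close>
        by (smt (verit) divide_nonneg_nonneg mult_nonneg_nonneg zero_le_even_power even_numeral zero_le_power2)
    next
      case False
      have "\<bar>f2 s - f2 x\<bar> \<le> 2 * K" if "s \<in> {0..1}" for s
        using K[OF that] K[OF x] by linarith
      then have "?R \<le> 2 * K * (t - x)\<^sup>2"
        by (intro Taylor2_within[where S = "{0..1}"] x t f1 f2) auto
      also have "\<dots> \<le> 2 * K * (t - x)\<^sup>2 * ((t - x)\<^sup>2 / d\<^sup>2)"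
      proof -
        have "d\<^sup>2 \<le> (t - x)\<^sup>2" using False \<open>d > 0\<close>
          by (metis linorder_not_less less_eq_real_def power2_abs power_mono)
        then have "1 \<le> (t - x)\<^sup>2 / d\<^sup>2" using \<open>d > 0\<close> by simp
        from mult_left_mono[OF this, of "2 * K * (t - x)\<^sup>2"] show ?thesis using \<open>K \<ge> 0\<close> by simp
      qed
      also have "\<dots> = 2 * K / d\<^sup>2 * (t - x)^4"
        by (simp add: power4_eq_xxxx power2_eq_square)
      also have "\<dots> \<le> \<epsilon> * (t - x)\<^sup>2 + 2 * K / d\<^sup>2 * (t - x)^4"
        using \<open>\<epsilon> > 0\<close> by simp
      finally show ?thesis .
    qed
  qed
qed

section \<open>Recurrence and central moments of the Bernstein basis\<close>

lemma Bernstein_Suc_Suc: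
  assumes "k \<le> n"
  shows "Bernstein (Suc n) (Suc k) x = x * Bernstein n k x + (1 - x) * Bernstein n (Suc k) x"
\<comment> \<open>For \<open>k = n\<close> the last term vanishes with its binomial coefficient;
  treating it apart avoids the truncated exponent \<open>n - Suc k\<close>.\<close>
proof (cases "k = n")
  case True
  then show ?thesis by (simp add: Bernstein_def)
next
  case False
  then have "n - k = Suc (n - Suc k)" using assms by simp
  then show ?thesis by (simp add: Bernstein_def algebra_simps)
qed

text \<open>Conditioning on the last of \<open>n + 1\<close> Bernoulli trials with success
  probability \<open>x\<close>; this drives the induction for the fourth moment.\<close>

lemma sum_Bernstein_Suc:
  "(\<Sum>k\<le>Suc n. g k * Bernstein (Suc n) k x) =
   x * (\<Sum>k\<le>n. g (Suc k) * Bernstein n k x) + (1 - x) * (\<Sum>k\<le>n. g k * Bernstein n k x)"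
proof -
  have "(\<Sum>k\<le>Suc n. g k * Bernstein (Suc n) k x) =
      g 0 * Bernstein (Suc n) 0 x + (\<Sum>k\<le>n. g (Suc k) * Bernstein (Suc n) (Suc k) x)"
    by (rule sum.atMost_Suc_shift)
  also have "(\<Sum>k\<le>n. g (Suc k) * Bernstein (Suc n) (Suc k) x) =
      x * (\<Sum>k\<le>n. g (Suc k) * Bernstein n k x) + (1 - x) * (\<Sum>k\<le>n. g (Suc k) * Bernstein n (Suc k) x)"
    unfolding sum_distrib_left sum.distrib[symmetric]
    by (intro sum.cong) (auto simp: Bernstein_Suc_Suc algebra_simps)
  also have "g 0 * Bernstein (Suc n) 0 x = (1 - x) * (g 0 * Bernstein n 0 x)"
    by (simp add: Bernstein_def)
  also have "(1 - x) * (g 0 * Bernstein n 0 x) + (x * (\<Sum>k\<le>n. g (Suc k) * Bernstein n k x)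
      + (1 - x) * (\<Sum>k\<le>n. g (Suc k) * Bernstein n (Suc k) x)) =
      x * (\<Sum>k\<le>n. g (Suc k) * Bernstein n k x) + (1 - x) * (\<Sum>k\<le>Suc n. g k * Bernstein n k x)"
    by (subst sum.atMost_Suc_shift) (simp add: algebra_simps)
  also have "(\<Sum>k\<le>Suc n. g k * Bernstein n k x) = (\<Sum>k\<le>n. g k * Bernstein n k x)"
    by (simp add: Bernstein_def)
  finally show ?thesis .
qed

lemma Bernstein_central_moment1: "(\<Sum>k\<le>n. (real k - n * x) * Bernstein n k x) = 0"
  by (simp add: left_diff_distrib sum_subtractf flip: sum_distrib_left)

lemma Bernstein_central_moment2:
  "(\<Sum>k\<le>n. (real k - n * x)\<^sup>2 * Bernstein n k x) = n * (x * (1 - x))"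
proof -
  \<comment> \<open>The square is split along \<open>k * (k - 1)\<close>, \<open>k\<close> and 1,
    whose Bernstein sums have known closed forms.\<close>
  have "(a - b)\<^sup>2 * c = a * (a - 1) * c + (1 - 2 * b) * (a * c) + b * b * c" for a b c :: real
    by (simp add: algebra_simps power2_eq_square)
  then show ?thesis
    by (simp add: sum.distrib flip: sum_distrib_left) (simp add: algebra_simps power2_eq_square)
qed

text \<open>Induction on the number of trials: one more trial raises the moment by
  \<open>6 * p * (n * p) + p * (1 - 3 * p)\<close>. As \<open>p\<close> is at most 1/4, this is at
  most \<open>2 * n + 1\<close>, the growth of the square.\<close>

lemma Bernstein_central_moment4_le:
  assumes x: "x \<in> {0..1}"
  shows "(\<Sum>k\<le>n. (real k - n * x)^4 * Bernstein n k x) \<le> (real n)\<^sup>2"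
proof (induction n)
  case 0
  show ?case by simp
next
  case (Suc n)
  define p where "p = x * (1 - x)"
  have p: "0 \<le> p" "p \<le> 1/4"
    using x zero_le_power2[of "x - 1/2"] by (simp add: p_def, simp add: p_def power2_eq_square algebra_simps)
  let ?Y = "\<lambda>k. real k - n * x" and ?b = "\<lambda>k. Bernstein n k x"
  have "(\<Sum>k\<le>Suc n. (real k - Suc n * x)^4 * Bernstein (Suc n) k x) =
    (\<Sum>k\<le>n. (x * (?Y k + 1 - x)^4 + (1 - x) * (?Y k - x)^4) * ?b k)"
    unfolding sum_Bernstein_Suc sum_distrib_left sum.distrib[symmetric]
    by (intro sum.cong) (auto simp: algebra_simps)
  \<comment> \<open>The centred trial takes the values \<open>1 - x\<close> and \<open>- x\<close>.
    Its mean is 0, so the cubic term drops out; its next moments are \<open>p\<close>,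
    \<open>p * (1 - 2 * x)\<close> and \<open>p * (1 - 3 * p)\<close>.\<close>
  also have "\<dots> = (\<Sum>k\<le>n. ?Y k^4 * ?b k + 6 * p * ((?Y k)\<^sup>2 * ?b k)
      + 4 * p * (1 - 2 * x) * (?Y k * ?b k) + p * (1 - 3 * p) * ?b k)"
  proof (rule sum.cong)
    fix k
    have "x * (y + 1 - x)^4 + (1 - x) * (y - x)^4 =
        y^4 + 6 * p * y\<^sup>2 + 4 * p * (1 - 2 * x) * y + p * (1 - 3 * p)" for y
      unfolding p_def by algebra
    then show "(x * (?Y k + 1 - x)^4 + (1 - x) * (?Y k - x)^4) * ?b k =
      ?Y k^4 * ?b k + 6 * p * ((?Y k)\<^sup>2 * ?b k) + 4 * p * (1 - 2 * x) * (?Y k * ?b k)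
      + p * (1 - 3 * p) * ?b k"
      by (simp only: distrib_right mult.assoc)
  qed simp
  also have "\<dots> = (\<Sum>k\<le>n. ?Y k^4 * ?b k) + 6 * p * (n * p) + p * (1 - 3 * p)"
    by (simp only: sum.distrib sum_distrib_left[symmetric] Bernstein_central_moment1
      Bernstein_central_moment2 sum_Bernstein p_def)
  also have "\<dots> \<le> (real n)\<^sup>2 + 2 * n + 1"
  proof -
    have "p * p \<le> 1/4 * (1/4)" using p by (intro mult_mono) auto
    then have "6 * p * p * n \<le> 2 * real n" by (intro mult_right_mono) auto
    moreover have "p * (1 - 3 * p) \<le> 1 * 1" using p by (intro mult_mono') auto
    ultimately show ?thesis using Suc by (simp add: mult_ac)
  qed
  finally show ?case by (simp add: power2_eq_square algebra_simps)
qed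

section \<open>Quantitative Voronovskaya estimate\<close>

lemma Bernstein_op_affine_quadratic:
  assumes "n \<ge> 1"
  shows "Bernstein_op n (\<lambda>t. a + b * (t - x) + c * (t - x)\<^sup>2) x = a + c * (x * (1 - x)) / n"
proof -
  have "(a + b * (real k / n - x) + c * (real k / n - x)\<^sup>2) * Bernstein n k x =
      a * Bernstein n k x + b / n * ((real k - n * x) * Bernstein n k x)
       + c / n\<^sup>2 * ((real k - n * x)\<^sup>2 * Bernstein n k x)" for k
    using assms by (simp add: field_simps power2_eq_square)
  then have "Bernstein_op n (\<lambda>t. a + b * (t - x) + c * (t - x)\<^sup>2) x =
      a * (\<Sum>k\<le>n. Bernstein n k x) + b / n * (\<Sum>k\<le>n. (real k - n * x) * Bernstein n k x)
       + c / n\<^sup>2 * (\<Sum>k\<le>n. (real k - n * x)\<^sup>2 * Bernstein n k x)"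
    by (simp only: Bernstein_op_def atLeast0AtMost sum.distrib sum_distrib_left)
  then show ?thesis using assms
    by (simp add: Bernstein_central_moment1 Bernstein_central_moment2 power2_eq_square[of "real n"])
qed

lemma Bernstein_op_diff:
  "Bernstein_op n f x - Bernstein_op n g x = Bernstein_op n (\<lambda>t. f t - g t) x"
  by (simp add: Bernstein_op_def left_diff_distrib sum_subtractf)

text \<open>The basis is nonnegative, so the pointwise bound can be averaged: the second moment
  yields the \<open>1 / n\<close> term, the fourth moment the \<open>1 / n\<^sup>2\<close>
  term.\<close>

lemma Bernstein_op_quartic_bound:
  assumes "n \<ge> 1" "x \<in> {0..1}" "C \<ge> 0"
    and R: "\<And>t. t \<in> {0..1} \<Longrightarrow> \<bar>R t\<bar> \<le> \<epsilon> * (t - x)\<^sup>2 + C * (t - x)^4"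
  shows "\<bar>Bernstein_op n R x\<bar> \<le> \<epsilon> * (x * (1 - x)) / n + C / n\<^sup>2"
proof -
  have "\<bar>Bernstein_op n R x\<bar> \<le> (\<Sum>k\<le>n. \<bar>R (k / n) * Bernstein n k x\<bar>)"
    unfolding Bernstein_op_def atLeast0AtMost by (rule sum_abs)
  also have "\<dots> \<le> (\<Sum>k\<le>n. \<epsilon> / n\<^sup>2 * ((real k - n * x)\<^sup>2 * Bernstein n k x) +
      C / n^4 * ((real k - n * x)^4 * Bernstein n k x))"
  proof (rule sum_mono)
    fix k assume "k \<in> {..n}"
    then have "real k / n \<in> {0..1}" using assms by auto
    then have "\<bar>R (k / n) * Bernstein n k x\<bar> \<le>
        (\<epsilon> * (real k / n - x)\<^sup>2 + C * (real k / n - x)^4) * Bernstein n k x"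
      using assms Bernstein_nonneg[of x n k] by (auto simp: abs_mult intro!: mult_right_mono R)
    also have "real k / n - x = (real k - n * x) / n" using assms by (simp add: field_simps)
    finally show "\<bar>R (k / n) * Bernstein n k x\<bar> \<le> \<epsilon> / n\<^sup>2 * ((real k - n * x)\<^sup>2 * Bernstein n k x) +
      C / n^4 * ((real k - n * x)^4 * Bernstein n k x)"
      by (simp add: power_divide distrib_right)
  qed
  also have "\<dots> = \<epsilon> / n\<^sup>2 * (n * (x * (1 - x))) + C / n^4 * (\<Sum>k\<le>n. (real k - n * x)^4 * Bernstein n k x)"
    by (simp only: sum.distrib sum_distrib_left[symmetric] Bernstein_central_moment2)
  also have "\<dots> \<le> \<epsilon> / n\<^sup>2 * (n * (x * (1 - x))) + C / n^4 * (real n)\<^sup>2"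
    using assms by (intro add_left_mono mult_left_mono Bernstein_central_moment4_le) auto
  also have "\<dots> = \<epsilon> * (x * (1 - x)) / n + C / n\<^sup>2"
    using assms by (simp add: power2_eq_square power4_eq_xxxx)
  finally show ?thesis .
qed

text \<open>The operator is computed exactly on the parabola, where the vanishing first moment
  removes \<open>b\<close>; the remainder falls under the quartic bound. In use \<open>c\<close> is
  the second derivative at \<open>x\<close>.\<close>

lemma Bernstein_op_Voronovskaya:
  assumes "n \<ge> 1" "x \<in> {0..1}" "C \<ge> 0"
    and R: "\<And>t. t \<in> {0..1} \<Longrightarrow>
      \<bar>f t - (f x + b * (t - x) + c / 2 * (t - x)\<^sup>2)\<bar> \<le> \<epsilon> * (t - x)\<^sup>2 + C * (t - x)^4"
  shows "\<bar>n * (Bernstein_op n f x - f x) - x * (1 - x) * c / 2\<bar> \<le> \<epsilon> * (x * (1 - x)) + C / n"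
proof -
  let ?D = "Bernstein_op n f x - f x - c / 2 * (x * (1 - x)) / n"
  have "\<bar>?D\<bar> \<le> \<epsilon> * (x * (1 - x)) / n + C / n\<^sup>2"
    using Bernstein_op_quartic_bound[OF assms(1-3) R]
    unfolding Bernstein_op_diff[symmetric] Bernstein_op_affine_quadratic[OF assms(1)]
    by (simp add: diff_diff_eq)
  then have "n * \<bar>?D\<bar> \<le> n * (\<epsilon> * (x * (1 - x)) / n + C / n\<^sup>2)"
    by (rule mult_left_mono) simp
  also have "\<dots> = \<epsilon> * (x * (1 - x)) + C / n"
    using assms(1) by (simp add: distrib_left power2_eq_square)
  also have "n * \<bar>?D\<bar> = \<bar>n * ?D\<bar>" by (simp add: abs_mult)
  also have "n * ?D = n * (Bernstein_op n f x - f x) - x * (1 - x) * c / 2"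
    using assms(1) by (simp add: field_simps)
  finally show ?thesis .
qed

section \<open>Second differences with the Ditzian-Totik step\<close>

lemma DT_phi_squared: "x \<in> {0..1} \<Longrightarrow> (DT_phi x)\<^sup>2 = x * (1 - x)"
  by (simp add: DT_phi_def)

lemma DT_phi_bounds: "x \<in> {0..1} \<Longrightarrow> DT_phi x \<in> {0..1}"
  by (auto simp: DT_phi_def mult_le_one)

lemma DT_phi_shift_in_unit:
  assumes h: "0 \<le> h" and x: "x \<in> {h\<^sup>2 / (1 + h\<^sup>2)..1 / (1 + h\<^sup>2)}"
  shows "x \<in> {0..1}" "x + h * DT_phi x \<in> {0..1}" "x - h * DT_phi x \<in> {0..1}"
proof -
  have pos: "1 + h\<^sup>2 > 0" by (smt (verit) zero_le_power2)
  \<comment> \<open>These restate the two interval conditions; multiplied by \<open>x\<close> and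
    \<open>1 - x\<close> respectively they compare the squared step with \<open>x\<^sup>2\<close>
    and \<open>(1 - x)\<^sup>2\<close>.\<close>
  have 1: "h\<^sup>2 * (1 - x) \<le> x" and 2: "h\<^sup>2 * x \<le> 1 - x"
    using x pos by (auto simp: pos_divide_le_eq pos_le_divide_eq algebra_simps)
  have "0 \<le> h\<^sup>2 / (1 + h\<^sup>2)" "1 / (1 + h\<^sup>2) \<le> 1" by (auto simp: add_pos_nonneg)
  moreover have "h\<^sup>2 / (1 + h\<^sup>2) \<le> x" "x \<le> 1 / (1 + h\<^sup>2)" using x by auto
  ultimately have "0 \<le> x" "x \<le> 1" by linarith+
  then show u: "x \<in> {0..1}" by simp
  have eq: "(h * DT_phi x)\<^sup>2 = h\<^sup>2 * x * (1 - x)"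
    using DT_phi_squared[OF u] by (simp add: power_mult_distrib)
  then have eq': "(h * DT_phi x)\<^sup>2 = h\<^sup>2 * (1 - x) * x" by (simp only: mult_ac)
  have "(h * DT_phi x)\<^sup>2 \<le> x\<^sup>2"
    unfolding eq' power2_eq_square[of x] by (rule mult_right_mono[OF 1]) (use u in simp)
  then have "h * DT_phi x \<le> x" by (rule power2_le_imp_le) (use u in simp)
  moreover have "(h * DT_phi x)\<^sup>2 \<le> (1 - x)\<^sup>2"
    unfolding eq power2_eq_square[of "1 - x"] by (rule mult_right_mono[OF 2]) (use u in simp)
  then have "h * DT_phi x \<le> 1 - x" by (rule power2_le_imp_le) (use u in simp)
  moreover have "h * DT_phi x \<ge> 0" using h DT_phi_bounds[OF u] by simp
  ultimately show "x + h * DT_phi x \<in> {0..1}" "x - h * DT_phi x \<in> {0..1}"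
    using u by auto
qed

text \<open>In the sum of the expansions at \<open>x + v\<close> and \<open>x - v\<close> the linear
  terms cancel and the quadratic ones give \<open>c * v\<^sup>2\<close>. The weight
  \<open>DT_phi\<close> thus produces the same factor \<open>x * (1 - x)\<close> as the Bernstein
  error. Note that \<open>\<delta>\<close> bounds the square of \<open>h\<close>; it will be
  \<open>1 / n\<close>.\<close>

lemma second_difference_expansion:
  assumes h: "0 \<le> h" "h\<^sup>2 \<le> \<delta>" and x: "x \<in> {h\<^sup>2 / (1 + h\<^sup>2)..1 / (1 + h\<^sup>2)}"
    and "\<epsilon> \<ge> 0" "C \<ge> 0"
    and R: "\<And>t. t \<in> {0..1} \<Longrightarrow>
      \<bar>f t - (f x + b * (t - x) + c / 2 * (t - x)\<^sup>2)\<bar> \<le> \<epsilon> * (t - x)\<^sup>2 + C * (t - x)^4"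
  shows "\<bar>(f (x + h * DT_phi x) - 2 * f x + f (x - h * DT_phi x)) - h\<^sup>2 * (x * (1 - x) * c)\<bar>
    \<le> 2 * (\<epsilon> * \<delta> + C * \<delta>\<^sup>2)"
proof -
  note u = DT_phi_shift_in_unit[OF h(1) x]
  define v where "v = h * DT_phi x"
  have v2: "v\<^sup>2 = h\<^sup>2 * (x * (1 - x))"
    using DT_phi_squared[OF u(1)] by (simp add: v_def power_mult_distrib)
  also have "\<dots> \<le> h\<^sup>2 * 1" using u(1) by (intro mult_left_mono) (auto simp: mult_le_one)
  also have "\<dots> \<le> \<delta>" using h by simp
  finally have v: "v\<^sup>2 \<le> \<delta>" .
  have "v^4 = (v\<^sup>2)\<^sup>2" by simp
  also have "\<dots> \<le> \<delta>\<^sup>2" using v by (intro power_mono) auto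
  finally have v4: "v^4 \<le> \<delta>\<^sup>2" .
  have "\<epsilon> * v\<^sup>2 + C * v^4 \<le> \<epsilon> * \<delta> + C * \<delta>\<^sup>2"
    using v v4 assms by (intro add_mono mult_left_mono) auto
  moreover have "\<bar>f (x + v) - (f x + b * v + c / 2 * v\<^sup>2)\<bar> \<le> \<epsilon> * v\<^sup>2 + C * v^4"
    using R[of "x + v"] u by (simp add: v_def)
  moreover have "\<bar>f (x - v) - (f x - b * v + c / 2 * v\<^sup>2)\<bar> \<le> \<epsilon> * v\<^sup>2 + C * v^4"
    using R[of "x - v"] u by (simp add: v_def)
  ultimately have "\<bar>(f (x + v) - 2 * f x + f (x - v)) - c * v\<^sup>2\<bar> \<le> 2 * (\<epsilon> * \<delta> + C * \<delta>\<^sup>2)"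
    by (simp add: abs_le_iff)
  then show ?thesis unfolding v2 by (simp add: v_def mult_ac)
qed

section \<open>Estimates for the suprema\<close>

lemma unif_norm_le: "(\<And>x. x \<in> {0..1} \<Longrightarrow> \<bar>g x\<bar> \<le> B) \<Longrightarrow> unif_norm g \<le> B"
  unfolding unif_norm_def by (rule cSUP_least) auto

lemma unif_norm_ge:
  assumes "\<And>x. x \<in> {0..1} \<Longrightarrow> \<bar>g x\<bar> \<le> B" and "x \<in> {0..1}"
  shows "\<bar>g x\<bar> \<le> unif_norm g"
  unfolding unif_norm_def by (rule cSUP_upper[OF assms(2)]) (rule bdd_aboveI2, rule assms(1))

lemma DT_domain_nonempty:
  fixes h \<delta> :: real
  assumes "h \<in> {0..\<delta>}" "\<delta> \<le> 1"
  shows "{h\<^sup>2 / (1 + h\<^sup>2)..1 / (1 + h\<^sup>2)} \<noteq> {}"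
proof -
  have "h\<^sup>2 \<le> 1" using assms by (intro power_le_one) auto
  then show ?thesis by (auto intro!: divide_right_mono)
qed

text \<open>\<open>B\<close> serves both directions: it bounds the modulus, and it supplies the
  boundedness that both nested suprema require before a single difference can be placed below
  them.\<close>

lemma
  fixes f :: "real \<Rightarrow> real"
  assumes \<delta>: "0 \<le> \<delta>" "\<delta> \<le> 1"
    and B: "\<And>h x. h \<in> {0..\<delta>} \<Longrightarrow> x \<in> {h\<^sup>2 / (1 + h\<^sup>2)..1 / (1 + h\<^sup>2)} \<Longrightarrow>
      \<bar>f (x + h * DT_phi x) - 2 * f x + f (x - h * DT_phi x)\<bar> \<le> B"
  shows DT_modulus2_le: "DT_modulus2 f \<delta> \<le> B"
    and DT_modulus2_ge: "\<lbrakk>h \<in> {0..\<delta>}; x \<in> {h\<^sup>2 / (1 + h\<^sup>2)..1 / (1 + h\<^sup>2)}\<rbrakk> \<Longrightarrow>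
      \<bar>f (x + h * DT_phi x) - 2 * f x + f (x - h * DT_phi x)\<bar> \<le> DT_modulus2 f \<delta>"
proof -
  let ?D = "\<lambda>h x. \<bar>f (x + h * DT_phi x) - 2 * f x + f (x - h * DT_phi x)\<bar>"
  let ?I = "\<lambda>h. {h\<^sup>2 / (1 + h\<^sup>2)..1 / (1 + h\<^sup>2)}"
  have inner: "(SUP x\<in>?I h. ?D h x) \<le> B" if "h \<in> {0..\<delta>}" for h
    by (rule cSUP_least[OF DT_domain_nonempty[OF that \<delta>(2)] B[OF that]])
  show "DT_modulus2 f \<delta> \<le> B"
    unfolding DT_modulus2_def by (rule cSUP_least[OF _ inner]) (use \<delta> in simp)
  assume h: "h \<in> {0..\<delta>}" and x: "x \<in> ?I h"
  have "?D h x \<le> (SUP x\<in>?I h. ?D h x)"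
    by (rule cSUP_upper[OF x]) (rule bdd_aboveI2, rule B[OF h])
  also have "\<dots> \<le> DT_modulus2 f \<delta>"
    unfolding DT_modulus2_def by (rule cSUP_upper[OF h]) (rule bdd_aboveI2, rule inner)
  finally show "?D h x \<le> DT_modulus2 f \<delta>" .
qed

section \<open>Two-sided bounds for the scaled error and modulus\<close>

text \<open>Upper bounds use any majorant \<open>M\<close> of the weighted second derivative, lower
  bounds a single point \<open>y\<close>. With \<open>y\<close> a maximiser the main terms match:
  \<open>M / 2\<close> for the error and \<open>M\<close> for the modulus.\<close>

lemma
  fixes f f1 f2 :: "real \<Rightarrow> real" and n :: nat
  assumes n: "n \<ge> 1" and \<epsilon>C: "\<epsilon> \<ge> 0" "C \<ge> 0"
    and R: "\<And>x t. x \<in> {0..1} \<Longrightarrow> t \<in> {0..1} \<Longrightarrow>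
      \<bar>f t - (f x + f1 x * (t - x) + f2 x / 2 * (t - x)\<^sup>2)\<bar> \<le> \<epsilon> * (t - x)\<^sup>2 + C * (t - x)^4"
    and M: "\<And>x. x \<in> {0..1} \<Longrightarrow> \<bar>x * (1 - x) * f2 x\<bar> \<le> M"
  shows unif_norm_Bernstein_error_le:
      "n * unif_norm (\<lambda>x. f x - Bernstein_op n f x) \<le> M / 2 + (\<epsilon> + C / n)"
    and unif_norm_Bernstein_error_ge: "y \<in> {0..1} \<Longrightarrow>
      \<bar>y * (1 - y) * f2 y\<bar> / 2 - (\<epsilon> + C / n) \<le> n * unif_norm (\<lambda>x. f x - Bernstein_op n f x)"
    and DT_modulus2_expansion_le:
      "n * DT_modulus2 f (1 / sqrt n) \<le> M + 2 * (\<epsilon> + C / n)"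
    and DT_modulus2_expansion_ge: "y \<in> {1 / (n + 1)..n / (n + 1)} \<Longrightarrow>
      \<bar>y * (1 - y) * f2 y\<bar> - 2 * (\<epsilon> + C / n) \<le> n * DT_modulus2 f (1 / sqrt n)"
proof -
  have npos: "real n > 0" using n by simp
  let ?E = "\<lambda>x. f x - Bernstein_op n f x" and ?w = "\<lambda>x. x * (1 - x) * f2 x"
  let ?\<eta> = "\<epsilon> + C / n"
  have V: "\<bar>n * (Bernstein_op n f x - f x) - ?w x / 2\<bar> \<le> ?\<eta>" if x: "x \<in> {0..1}" for x
  proof -
    have "\<epsilon> * (x * (1 - x)) \<le> \<epsilon> * 1"
      using x \<epsilon>C by (intro mult_left_mono) (auto simp: mult_le_one)
    then show ?thesis
      using Bernstein_op_Voronovskaya[OF n x \<epsilon>C(2) R[OF x]] by simp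
  qed
  have nE: "n * \<bar>?E x\<bar> = \<bar>n * (Bernstein_op n f x - f x)\<bar>" for x
    by (simp add: abs_mult abs_minus_commute)
  \<comment> \<open>Used for the upper bound and again as the boundedness required by
    \<open>unif_norm_ge\<close>.\<close>
  have E: "\<bar>?E x\<bar> \<le> (M / 2 + ?\<eta>) / n" if x: "x \<in> {0..1}" for x
    using V[OF x] M[OF x] nE[of x] npos by (simp add: pos_le_divide_eq mult.commute)
  show "n * unif_norm ?E \<le> M / 2 + ?\<eta>"
    using unif_norm_le[of ?E, OF E] npos by (simp add: pos_le_divide_eq mult.commute)
  show "\<bar>?w y\<bar> / 2 - ?\<eta> \<le> n * unif_norm ?E" if y: "y \<in> {0..1}"
  proof -
    have "\<bar>?w y\<bar> / 2 - ?\<eta> \<le> n * \<bar>?E y\<bar>" using V[OF y] nE[of y] by linarith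
    also have "\<dots> \<le> n * unif_norm ?E"
      using unif_norm_ge[of ?E, OF E y] by (intro mult_left_mono) auto
    finally show ?thesis .
  qed
  let ?D = "\<lambda>h x. f (x + h * DT_phi x) - 2 * f x + f (x - h * DT_phi x)"
  have \<delta>: "0 \<le> 1 / sqrt n" "1 / sqrt n \<le> 1" using n by auto
  have \<eta>: "2 * (\<epsilon> * (1 / n) + C * (1 / n)\<^sup>2) = 2 * ?\<eta> / n"
    using npos by (simp add: field_simps power2_eq_square)
  have D: "\<bar>?D h x - h\<^sup>2 * ?w x\<bar> \<le> 2 * ?\<eta> / n" and h2: "h\<^sup>2 \<le> 1 / n"
    and x01: "x \<in> {0..1}"
    if h: "h \<in> {0..1 / sqrt n}" and x: "x \<in> {h\<^sup>2 / (1 + h\<^sup>2)..1 / (1 + h\<^sup>2)}" for h x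
  proof -
    have "h\<^sup>2 \<le> (1 / sqrt n)\<^sup>2" using h by (intro power_mono) auto
    then show h2: "h\<^sup>2 \<le> 1 / n" by (simp add: power_divide)
    show x01: "x \<in> {0..1}" using DT_phi_shift_in_unit[OF _ x] h by auto
    show "\<bar>?D h x - h\<^sup>2 * ?w x\<bar> \<le> 2 * ?\<eta> / n"
      using second_difference_expansion[OF _ h2 x \<epsilon>C R[OF x01]] h unfolding \<eta> by simp
  qed
  have upper: "\<bar>?D h x\<bar> \<le> (M + 2 * ?\<eta>) / n"
    if h: "h \<in> {0..1 / sqrt n}" and x: "x \<in> {h\<^sup>2 / (1 + h\<^sup>2)..1 / (1 + h\<^sup>2)}" for h x
  proof -
    have "h\<^sup>2 * \<bar>?w x\<bar> \<le> 1 / n * M"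
      using h2[OF h x] M[OF x01[OF h x]] by (intro mult_mono) auto
    then have "\<bar>h\<^sup>2 * ?w x\<bar> \<le> M / n" by (simp add: abs_mult)
    then show ?thesis using D[OF h x] by (simp add: add_divide_distrib)
  qed
  show "n * DT_modulus2 f (1 / sqrt n) \<le> M + 2 * ?\<eta>"
    using DT_modulus2_le[OF \<delta> upper] npos by (simp add: pos_le_divide_eq mult.commute)
  show "\<bar>?w y\<bar> - 2 * ?\<eta> \<le> n * DT_modulus2 f (1 / sqrt n)"
    if y: "y \<in> {1 / (n + 1)..n / (n + 1)}"
  proof -
    \<comment> \<open>The largest admissible step; for it the range of \<open>x\<close> is exactly
      from \<open>1 / (n + 1)\<close> to \<open>n / (n + 1)\<close>.\<close>
    define h where "h = 1 / sqrt n"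
    have h2: "h\<^sup>2 = 1 / n" by (simp add: h_def power_divide)
    have h: "h \<in> {0..1 / sqrt n}" by (simp add: h_def)
    have dom: "y \<in> {h\<^sup>2 / (1 + h\<^sup>2)..1 / (1 + h\<^sup>2)}"
      using y npos unfolding h2 by (simp add: field_simps)
    have eq: "\<bar>h\<^sup>2 * ?w y\<bar> = \<bar>?w y\<bar> / n" by (simp add: h2 abs_mult)
    have "\<bar>?w y\<bar> / n - 2 * ?\<eta> / n \<le> \<bar>?D h y\<bar>"
      using order_trans[OF abs_triangle_ineq2_sym D[OF h dom]] unfolding eq
      by (simp only: diff_le_eq add.commute)
    also have "\<dots> \<le> DT_modulus2 f (1 / sqrt n)"
      by (rule DT_modulus2_ge[OF \<delta> upper h dom])
    finally show ?thesis using npos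
      by (simp add: pos_divide_le_eq mult.commute flip: diff_divide_distrib)
  qed
qed

section \<open>Comparison of error and modulus for large n\<close>

theorem theorem1:
  fixes f :: "real \<Rightarrow> real" and \<mu>\<^sub>0 :: real
  assumes "C2_unit f" and "0 < \<mu>\<^sub>0" and "\<mu>\<^sub>0 < 1"
  shows "\<exists>n\<^sub>1::nat. n\<^sub>1 \<ge> 1 \<and> (\<forall>n\<ge>n\<^sub>1.
           \<mu>\<^sub>0 / 32 * DT_modulus2 f (1 / sqrt (real n)) \<le> unif_norm (\<lambda>x. f x - Bernstein_op n f x) \<and>
           unif_norm (\<lambda>x. f x - Bernstein_op n f x) \<le> 3 * DT_modulus2 f (1 / sqrt (real n)))"
proof -
  obtain f1 f2 where f1: "\<And>s. s \<in> {0..1} \<Longrightarrow> (f has_real_derivative f1 s) (at s within {0..1})"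
    and f2: "\<And>s. s \<in> {0..1} \<Longrightarrow> (f1 has_real_derivative f2 s) (at s within {0..1})"
    and cont: "continuous_on {0..1} f2"
    using assms(1) unfolding C2_unit_def by blast
  let ?w = "\<lambda>x. x * (1 - x) * f2 x"
  let ?U = "\<lambda>n. unif_norm (\<lambda>x. f x - Bernstein_op n f x)" and ?D = "\<lambda>n. DT_modulus2 f (1 / sqrt (real n))"
  have "continuous_on {0..1} (\<lambda>x. \<bar>?w x\<bar>)" by (intro continuous_intros cont)
  then obtain z where z: "z \<in> {0..1}" and max: "\<And>x. x \<in> {0..1} \<Longrightarrow> \<bar>?w x\<bar> \<le> \<bar>?w z\<bar>"
    using continuous_attains_sup[of "{0..1::real}" "\<lambda>x. \<bar>?w x\<bar>"] by auto
  define M where "M = \<bar>?w z\<bar>"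
  have M: "\<And>x. x \<in> {0..1} \<Longrightarrow> \<bar>?w x\<bar> \<le> M" using max by (simp add: M_def)
  \<comment> \<open>With total error at most \<open>M / 4\<close>, the scaled norm lies between
    \<open>M / 4\<close> and \<open>3 * M / 4\<close>, the scaled modulus between
    \<open>M / 2\<close> and \<open>3 * M / 2\<close>; both constants then hold with room to
    spare.\<close>
  have conclude: "\<mu>\<^sub>0 / 32 * ?D n \<le> ?U n \<and> ?U n \<le> 3 * ?D n"
    if n: "n \<ge> 1" and \<epsilon>C: "\<epsilon> \<ge> 0" "C \<ge> 0" and \<eta>: "\<epsilon> + C / n \<le> M / 4"
      and R: "\<And>x t. x \<in> {0..1} \<Longrightarrow> t \<in> {0..1} \<Longrightarrow>
        \<bar>f t - (f x + f1 x * (t - x) + f2 x / 2 * (t - x)\<^sup>2)\<bar> \<le> \<epsilon> * (t - x)\<^sup>2 + C * (t - x)^4"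
      and y: "y \<in> {0..1}" "y \<in> {1 / real (n + 1)..real n / real (n + 1)}" "\<bar>?w y\<bar> = M"
    for n :: nat and \<epsilon> C y :: real
  proof -
    have "M \<ge> 0" by (simp add: M_def)
    define e where "e = \<epsilon> + C / n"
    note e = \<eta>[folded e_def]
    have U1: "n * ?U n \<le> M / 2 + e"
      unfolding e_def by (rule unif_norm_Bernstein_error_le[OF n \<epsilon>C R M])
    have U2: "M / 2 - e \<le> n * ?U n"
      unfolding e_def y(3)[symmetric] by (rule unif_norm_Bernstein_error_ge[OF n \<epsilon>C R M y(1)])
    have D1: "n * ?D n \<le> M + 2 * e"
      unfolding e_def by (rule DT_modulus2_expansion_le[OF n \<epsilon>C R M])
    have D2: "M - 2 * e \<le> n * ?D n"
      unfolding e_def y(3)[symmetric] by (rule DT_modulus2_expansion_ge[OF n \<epsilon>C R M y(2)])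
    \<comment> \<open>The sign is what permits replacing \<open>\<mu>\<^sub>0\<close> by 1.\<close>
    have "0 \<le> n * ?D n" using D2 e \<open>M \<ge> 0\<close> by linarith
    then have "\<mu>\<^sub>0 / 32 * (n * ?D n) \<le> 1 / 32 * (n * ?D n)"
      using assms(2,3) by (intro mult_right_mono) auto
    also have "\<dots> \<le> n * ?U n" using U2 D1 e \<open>M \<ge> 0\<close> by linarith
    finally have "n * (\<mu>\<^sub>0 / 32 * ?D n) \<le> n * ?U n" by (simp only: mult_ac)
    moreover have "n * ?U n \<le> n * (3 * ?D n)" using U1 D2 e \<open>M \<ge> 0\<close> by linarith
    ultimately show ?thesis using n by (simp add: mult_le_cancel_left_pos)
  qed
  show ?thesis
  proof (cases "M = 0")
    case True
    \<comment> \<open>The weight is positive only in the interior; continuity then carries the zero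
      to the endpoints.\<close>
    have "f2 s = 0" if "s \<in> {0<..<1}" for s
      using M[of s] that True by auto
    then have f2_0: "f2 s = 0" if "s \<in> {0..1}" for s
      using continuous_constant_on_closure[of "{0<..<1::real}" f2 0 s] cont that by simp
    have R: "\<bar>f t - (f x + f1 x * (t - x) + f2 x / 2 * (t - x)\<^sup>2)\<bar> \<le> 0 * (t - x)\<^sup>2 + 0 * (t - x)^4"
      if "x \<in> {0..1}" "t \<in> {0..1}" for x t
      using Taylor2_within[OF _ that f1 f2, of 0] f2_0 that by simp
    have "\<mu>\<^sub>0 / 32 * ?D n \<le> ?U n \<and> ?U n \<le> 3 * ?D n" if n: "n \<ge> 1" for n
    proof (rule conclude[OF n order_refl order_refl _ R])
      \<comment> \<open>Every point is a maximiser now; 1/2 is admissible from \<open>n = 1\<close>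
        on, where the interval is that single point.\<close>
      show "1 / 2 \<in> {1 / real (n + 1)..real n / real (n + 1)}" using n by (auto simp: field_simps)
    qed (use True f2_0 in auto)
    then show ?thesis by blast
  next
    case False
    then have "M > 0" by (simp add: M_def)
    \<comment> \<open>The weight vanishes at 0 and 1, so a positive maximum is attained
      inside.\<close>
    then have z01: "0 < z" "z < 1" using z by (auto simp: M_def less_le)
    \<comment> \<open>Half of the allowance \<open>M / 4\<close>; the other half is for
      \<open>C / n\<close>.\<close>
    define \<epsilon> where "\<epsilon> = M / 8"
    have "\<epsilon> > 0" using \<open>M > 0\<close> by (simp add: \<epsilon>_def)
    from Taylor2_remainder_quartic[OF f1 f2 cont this] obtain C where "C \<ge> 0" and
      R: "\<And>x t. x \<in> {0..1} \<Longrightarrow> t \<in> {0..1} \<Longrightarrow>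
        \<bar>f t - (f x + f1 x * (t - x) + f2 x / 2 * (t - x)\<^sup>2)\<bar> \<le> \<epsilon> * (t - x)\<^sup>2 + C * (t - x)^4"
      by blast
    \<comment> \<open>The first summand forces \<open>C / n\<close> below \<open>M / 8\<close>; the
      other two make \<open>z\<close> an admissible point for the step
      \<open>1 / sqrt n\<close>.\<close>
    obtain N :: nat where N: "8 * C / M + 1 / z + 1 / (1 - z) \<le> N"
      using real_arch_simple by blast
    have "\<mu>\<^sub>0 / 32 * ?D n \<le> ?U n \<and> ?U n \<le> 3 * ?D n" if "n \<ge> Suc N" for n
    proof -
      have n: "n \<ge> 1" and "real n \<ge> N" using that by auto
      moreover have "8 * C / M \<ge> 0" "1 / z \<ge> 0" "1 / (1 - z) \<ge> 0"
        using \<open>C \<ge> 0\<close> \<open>M > 0\<close> z01 by auto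
      ultimately have le: "8 * C / M \<le> n" "1 / z \<le> n" "1 / (1 - z) \<le> n" using N by linarith+
      have "C / n \<le> M / 8" using le(1) n \<open>M > 0\<close> by (simp add: field_simps)
      then have \<eta>: "\<epsilon> + C / n \<le> M / 4" unfolding \<epsilon>_def by linarith
      have "1 \<le> n * z" "1 \<le> n * (1 - z)" using le z01 by (simp_all add: pos_divide_le_eq)
      then have dom: "z \<in> {1 / real (n + 1)..real n / real (n + 1)}"
        using z01 by (simp add: field_simps)
      show ?thesis
        by (rule conclude[OF n less_imp_le[OF \<open>\<epsilon> > 0\<close>] \<open>C \<ge> 0\<close> \<eta> R z dom M_def[symmetric]])
    qed
    then show ?thesis by (intro exI[of _ "Suc N"]) auto
  qed
qed

end
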